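(* Let $m\ge1$, $T>0$, $\nu>0$, let $P_A,P_B$ be real symmetric $m\times m$ matrices and let $x_0\in\mathbb{R}^{2m}$. Let $u:[0,T]\to\mathbb{R}$ be any piecewise continuous control with $|u(t)|\le\nu$ for all $t\in[0,T]$, put $P(t)=P_A+u(t)P_B$, and let $x(\cdot)=(y(\cdot),z(\cdot))$, with $y(t),z(t)\in\mathbb{R}^m$, be the solution on $[0,T]$ of $$\dot y(t)=P(t)z(t),\qquad \dot z(t)=-P(t)y(t),\qquad x(0)=x_0.$$ Then $\|x(t)\|^2=\|y(t)\|^2+\|z(t)\|^2$ is constant on $[0,T]$; that is, independently of the choice of control, every trajectory lies on a sphere centred at the origin: $\|x(t)\|=\|x_0\|$ for all $t\in[0,T]$.
   Context: $\|\cdot\|$ denotes the Euclidean norm of a vector. Solutions are understood in the classical sense: the trajectory $x(\cdot)$ is continuous on $[0,T]$ with piecewise continuous derivative, and satisfies the differential equations at all points of $[0,T]$ except the finitely many discontinuity points of the control. *)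

theory Defs
  imports "HOL-Analysis.Analysis"
begin

definition discontinuities :: "real \<Rightarrow> real \<Rightarrow> (real \<Rightarrow> 'a::topological_space) \<Rightarrow> real set"
  where "discontinuities a b f = {t \<in> {a..b}. \<not> continuous (at t within {a..b}) f}"

(* Finitely many discontinuities, all with (finite) one-sided limits. Only the
   values of f on {a..b} matter. *)
definition piecewise_continuous :: "real \<Rightarrow> real \<Rightarrow> (real \<Rightarrow> 'a::topological_space) \<Rightarrow> bool"
  where "piecewise_continuous a b f \<longleftrightarrow>
    finite (discontinuities a b f) \<and>
    (\<forall>t\<in>{a..<b}. \<exists>l. (f \<longlongrightarrow> l) (at_right t)) \<and>
    (\<forall>t\<in>{a<..b}. \<exists>l. (f \<longlongrightarrow> l) (at_left t))"

(* The derivative of x may fail to exist at finitely many points, where the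
   values of the representative x' are irrelevant. Derivatives at the endpoints
   of {a..b} are one-sided. *)
definition has_piecewise_continuous_derivative ::
    "real \<Rightarrow> real \<Rightarrow> (real \<Rightarrow> 'a::real_normed_vector) \<Rightarrow> bool"
  where "has_piecewise_continuous_derivative a b x \<longleftrightarrow>
    (\<exists>x' S. finite S \<and> piecewise_continuous a b x' \<and>
      (\<forall>t\<in>{a..b} - S. (x has_vector_derivative x' t) (at t within {a..b})))"

(* Classical solution on {0..T} of the initial value problem x' = f t x, x 0 = x0,
   where the right-hand side f depends on time through the control u. *)
definition classical_solution ::
    "real \<Rightarrow> (real \<Rightarrow> real) \<Rightarrow> (real \<Rightarrow> 'a \<Rightarrow> 'a::real_normed_vector) \<Rightarrow> 'a \<Rightarrow> (real \<Rightarrow> 'a) \<Rightarrow> bool"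
  where "classical_solution T u f x0 x \<longleftrightarrow>
    continuous_on {0..T} x \<and>
    has_piecewise_continuous_derivative 0 T x \<and>
    (\<forall>t\<in>{0..T} - discontinuities 0 T u.
      (x has_vector_derivative f t (x t)) (at t within {0..T})) \<and>
    x 0 = x0"

definition control_matrix ::
    "real^'m^'m \<Rightarrow> real^'m^'m \<Rightarrow> (real \<Rightarrow> real) \<Rightarrow> real \<Rightarrow> real^'m^'m"
  where "control_matrix PA PB u t = PA + u t *\<^sub>R PB"

(* A point of R^(2m) is a pair (y, z) of vectors in R^m; the library norm on the
   product type is the Euclidean norm of the concatenated vector. *)
definition control_field ::
    "real^'m^'m \<Rightarrow> real^'m^'m \<Rightarrow> (real \<Rightarrow> real) \<Rightarrow>
     real \<Rightarrow> (real^'m) \<times> (real^'m) \<Rightarrow> (real^'m) \<times> (real^'m)"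
  where "control_field PA PB u t = (\<lambda>(y, z).
    (control_matrix PA PB u t *v z, - control_matrix PA PB u t *v y))"

end

theory Submission
  imports Defs
begin

text \<open>
  The Euclidean norm is conserved because the field is skew: with \<open>P\<close> symmetric,
  \<open>(y, z) \<bullet> (P z, - P y) = y \<bullet> P z - z \<bullet> P y = 0\<close> (lemma \<open>control_field_orthogonal\<close>), whatever
  the value of the control.  Hence \<open>\<parallel>x\<parallel>\<^sup>2\<close> has derivative \<open>2 x \<bullet> x' = 0\<close> at each point of continuity
  of the control.  The finitely many remaining times do no harm because the trajectory is
  continuous across them (lemma \<open>norm_const_if_orthogonal_derivative\<close>).
\<close>

text \<open>
  A velocity tangent to the spheres about the origin cannot move a curve off its sphere.
  Continuity is required on all of the interval: without it the norm could jump at the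
  exceptional points.
\<close>
lemma norm_const_if_orthogonal_derivative:
  fixes x :: "real \<Rightarrow> 'a::real_inner"
  assumes "finite S" and cont: "continuous_on {a..b} x"
    and deriv: "\<And>t. t \<in> {a..b} - S \<Longrightarrow> (x has_vector_derivative v t) (at t within {a..b})"
    and orth: "\<And>t. t \<in> {a..b} - S \<Longrightarrow> x t \<bullet> v t = 0"
    and t: "t \<in> {a..b}"
  shows "norm (x t) = norm (x a)"
proof -
  have "x t \<bullet> x t = x a \<bullet> x a"
  proof (rule has_derivative_zero_unique_strong_interval[of S a b "\<lambda>t. x t \<bullet> x t"])
    show "((\<lambda>t. x t \<bullet> x t) has_derivative (\<lambda>h. 0)) (at s within {a..b})"
      if s: "s \<in> {a..b} - S" for s
    proof -
      have "(x has_derivative (\<lambda>h. h *\<^sub>R v s)) (at s within {a..b})"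
        using deriv[OF s] by (simp add: has_vector_derivative_def)
      from has_derivative_inner[OF this this] show ?thesis
        using orth[OF s] by (simp add: inner_commute)
    qed
  qed (use assms in \<open>auto intro!: continuous_intros\<close>)
  then show ?thesis
    by (simp add: norm_eq_sqrt_inner)
qed

lemma symmetric_matrix_inner_commute:
  fixes P :: "real^'m^'m"
  assumes "transpose P = P"
  shows "y \<bullet> (P *v z) = z \<bullet> (P *v y)"
  by (metis assms dot_lmul_matrix inner_commute transpose_matrix_vector)

lemma control_field_orthogonal:
  fixes PA PB :: "real^'m^'m"
  assumes "transpose PA = PA" "transpose PB = PB"
  shows "x \<bullet> control_field PA PB u t x = 0"
proof -
  have "transpose (control_matrix PA PB u t) = control_matrix PA PB u t"
    using assms by (simp add: control_matrix_def transpose_def vec_eq_iff)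
  from symmetric_matrix_inner_commute[OF this] show ?thesis
    using matrix_vector_mult_diff_rdistrib[of 0 "control_matrix PA PB u t"]
    by (cases x) (simp add: control_field_def)
qed

theorem mainTheorem2:
  fixes PA PB :: "real^'m^'m"
    and T \<nu> :: real
    and u :: "real \<Rightarrow> real"
    and x0 :: "(real^'m) \<times> (real^'m)"
    and y z :: "real \<Rightarrow> real^'m"
  assumes "T > 0"
    and "\<nu> > 0"
    and "transpose PA = PA"
    and "transpose PB = PB"
    and "piecewise_continuous 0 T u"
    and "\<forall>t\<in>{0..T}. \<bar>u t\<bar> \<le> \<nu>"
    and "classical_solution T u (control_field PA PB u) x0 (\<lambda>t. (y t, z t))"
  shows "(\<forall>t\<in>{0..T}. (norm (y t, z t))\<^sup>2 = (norm (y t))\<^sup>2 + (norm (z t))\<^sup>2) \<and>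
    (\<lambda>t. (norm (y t, z t))\<^sup>2) constant_on {0..T} \<and>
    (\<forall>t\<in>{0..T}. (y t, z t) \<in> sphere 0 (norm x0)) \<and>
    (\<forall>t\<in>{0..T}. norm (y t, z t) = norm x0)"
proof -
  let ?x = "\<lambda>t. (y t, z t)"
  have const: "norm (?x t) = norm x0" if "t \<in> {0..T}" for t
  proof -
    have "finite (discontinuities 0 T u)"
      using \<open>piecewise_continuous 0 T u\<close> by (simp add: piecewise_continuous_def)
    then have "norm (?x t) = norm (?x 0)"
    proof (rule norm_const_if_orthogonal_derivative[OF _ _ _ _ that])
      show "?x s \<bullet> control_field PA PB u s (?x s) = 0" for s
        by (rule control_field_orthogonal[OF assms(3,4)])
    qed (use assms(7) in \<open>auto simp: classical_solution_def\<close>)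
    then show ?thesis
      using assms(7) by (simp add: classical_solution_def)
  qed
  moreover have "(\<lambda>t. (norm (?x t))\<^sup>2) constant_on {0..T}"
    unfolding constant_on_def using const by auto
  moreover have "(norm (?x t))\<^sup>2 = (norm (y t))\<^sup>2 + (norm (z t))\<^sup>2" for t
    by (simp add: norm_Pair)
  moreover have "?x t \<in> sphere 0 (norm x0)" if "t \<in> {0..T}" for t
    using const[OF that] by simp
  ultimately show ?thesis
    by blast
qed

end
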